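(* For every positive integer $k\ne 2$, $$\sum_{j=0}^{k-1}(-1)^j\frac{S_3(k+2j-1,j)}{(k+1)(k+3)\cdots(k+2j-1)}=\sum_{j=0}^{k-1}(-1)^{k+j-1}\frac{d_3(k+2j-1,j)}{(k+1)(k+3)\cdots(k+2j-1)}.$$
   Context: For integers $n,l\ge 0$, $S_3(n,l)$ (the 3-associated Stirling number of the second kind) is the number of partitions of a set of $n$ elements into $l$ blocks, all with at least $3$ elements, with $S_3(0,0)=1$; and $d_3(n,l)$ is the number of permutations of a set of $n$ elements that have exactly $l$ cycles, all of length at least $3$, with $d_3(0,0)=1$. The product $(k+1)(k+3)\cdots(k+2j-1)$ has $j$ factors and equals $1$ (empty product) when $j=0$. *)

theory Defs
  imports Complex_Main "HOL-Library.Disjoint_Sets" "HOL-Combinatorics.Orbits"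
begin

definition S3 :: "nat \<Rightarrow> nat \<Rightarrow> nat" where
  "S3 n l = card {P. partition_on {..<n} P \<and> card P = l \<and> (\<forall>B\<in>P. 3 \<le> card B)}"

text \<open>
  The cycles of a permutation are counted as its orbits on the ground set, and the length of
  a cycle is the cardinality of the orbit. A fixed point is thus a cycle of length 1. Since
  \<open>p permutes {..<n}\<close> makes \<open>p\<close> the identity outside \<open>{..<n}\<close>, each permutation of the
  ground set is counted once.
\<close>

definition d3 :: "nat \<Rightarrow> nat \<Rightarrow> nat" where
  "d3 n l = card {p. p permutes {..<n} \<and> card (orbit p ` {..<n}) = l
                     \<and> (\<forall>x\<in>{..<n}. 3 \<le> card (orbit p x))}"

lemma S3_0_0: "S3 0 0 = 1"
proof -
  have "{P::nat set set. partition_on {..<0} P \<and> card P = 0 \<and> (\<forall>B\<in>P. 3 \<le> card B)} = {{}}"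
    by (auto simp: partition_on_empty)
  then show ?thesis by (simp add: S3_def)
qed

lemma d3_0_0: "d3 0 0 = 1"
  by (simp add: d3_def)

end

theory Submission
  imports Defs "HOL-Computational_Algebra.Formal_Power_Series"
begin

text \<open>
  Let \<open>f = e^x - 1 - x - x^2/2\<close> and \<open>g = -log(1 - x) - x - x^2/2\<close>. Removing the block (or the
  cycle) of a fixed element shows that the two counting functions have the exponential
  generating functions \<open>f^l / l!\<close> and \<open>g^l / l!\<close> (\<open>card_partitions_egf\<close>,
  \<open>card_permutations_egf\<close>). Since
  \<open>(k + 2j - 1)! / ((k + 1)(k + 3)...(k + 2j - 1)) = (k - 1)! 2^j (k/2)(k/2 + 1)...(k/2 + j - 1)\<close>,
  the two alternating sums are binomial series:
  with \<open>A = (1 + 2f/x^2)^(-1/2)\<close> and \<open>B = (1 + 2g/x^2)^(-1/2)\<close>, they equal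
  \<open>(k - 1)! [x^(k-1)] A^k\<close> and \<open>(-1)^(k-1) (k - 1)! [x^(k-1)] B^k\<close>
  (\<open>alternating_sum_eq_inv_sqrt_coeff\<close>).

  These coefficients are residues: \<open>[x^(k-1)] A^k\<close> is the residue of \<open>(x/A)^(-k) dx\<close>, and
  similarly for \<open>B\<close>. Under the substitution \<open>u = 1 - e^x\<close> the series
  \<open>(u/B(u))^2 = 2(-log(1 - u) - u)\<close> becomes \<open>2(e^x - 1 - x) = (x/A)^2\<close>. As
  \<open>du = -e^x dx\<close>, the change of variables formula for residues (\<open>fps_residue_compose\<close>)
  turns the second sum into \<open>(k - 1)! [x^(k-1)] A^k e^x\<close>. The difference of the two sums is
  therefore governed by the residue of \<open>Y^(-k) (e^x - 1) dx\<close> with \<open>Y = x/A\<close>. Because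
  \<open>Y^2 = 2(e^x - 1 - x)\<close>, this differential is \<open>Y^(1-k) dY\<close>, which is exact, hence without
  residue, unless \<open>k = 2\<close>.
\<close>

unbundle fps_syntax

section \<open>Exponential generating functions of partitions and permutations\<close>

lemma sum_Pow_card:
  fixes g :: "nat \<Rightarrow> 'b::comm_semiring_1"
  assumes "finite A"
  shows "(\<Sum>B\<in>Pow A. g (card B)) = (\<Sum>m=0..card A. of_nat (card A choose m) * g m)"
proof -
  have "(\<Sum>m=0..card A. \<Sum>B\<in>{B \<in> Pow A. card B = m}. g (card B)) = (\<Sum>B\<in>Pow A. g (card B))"
    using assms by (intro sum.group) (auto intro: card_mono)
  moreover have "(\<Sum>B\<in>{B \<in> Pow A. card B = m}. g (card B)) = of_nat (card A choose m) * g m" for m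
    using n_subsets[OF assms, of m] by simp
  ultimately show ?thesis by simp
qed

text \<open>
  Structures on a finite set that split into \<open>l\<close> blocks, where a block with \<open>m\<close> elements can be
  chosen in \<open>w m\<close> ways, have the exponential generating function \<open>W^l / l!\<close>, where \<open>W\<close> is that
  of the weights \<open>w\<close>. The recursion chooses the block \<open>insert a B\<close> of the element \<open>a\<close>; in
  terms of generating functions it says that the derivative of \<open>W^(l+1) / (l+1)!\<close> is \<open>W' W^l / l!\<close>.
\<close>

lemma block_count_egf:
  fixes N :: "'a set \<Rightarrow> nat \<Rightarrow> real" and w :: "nat \<Rightarrow> real"
  assumes "\<And>A. finite A \<Longrightarrow> N A 0 = (if A = {} then 1 else 0)"
    and "\<And>l. N {} (Suc l) = 0"
    and rec: "\<And>a A l. finite A \<Longrightarrow> a \<notin> A \<Longrightarrow>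
        N (insert a A) (Suc l) = (\<Sum>B\<in>Pow A. w (Suc (card B)) * N (A - B) l)"
    and "w 0 = 0" "finite A"
  shows "N A l = fact (card A) * (Abs_fps (\<lambda>m. w m / fact m) ^ l) $ card A / fact l"
  using \<open>finite A\<close>
proof (induction l arbitrary: A)
  case 0
  then show ?case using assms(1) by (auto simp: card_eq_0_iff)
next
  case (Suc l)
  define W where "W = Abs_fps (\<lambda>m. w m / fact m)"
  show ?case
  proof (cases "A = {}")
    case True
    then show ?thesis using assms(2,4) by simp
  next
    case False
    then obtain a A' where A: "A = insert a A'" "a \<notin> A'"
      by (meson ex_in_conv mk_disjoint_insert)
    then have fin: "finite A'" using Suc.prems by simp
    define n where "n = card A'"
    have "N A (Suc l)
        = (\<Sum>B\<in>Pow A'. w (Suc (card B)) * (fact (n - card B) * (W ^ l) $ (n - card B) / fact l))"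
      unfolding A(1) rec[OF fin A(2)] using fin
      by (intro sum.cong refl) (auto simp: Suc.IH W_def n_def card_Diff_subset finite_subset)
    also have "\<dots> = (\<Sum>m=0..n. real (n choose m)
        * (w (Suc m) * (fact (n - m) * (W ^ l) $ (n - m) / fact l)))"
      unfolding n_def by (rule sum_Pow_card[OF fin,
          where g = "\<lambda>m. w (Suc m) * (fact (card A' - m) * (W ^ l) $ (card A' - m) / fact l)"])
    also have "\<dots> = (\<Sum>m=0..n. fact n / fact l * (fps_deriv W $ m * (W ^ l) $ (n - m)))"
    proof (intro sum.cong refl)
      fix m assume "m \<in> {0..n}"
      moreover have "fps_deriv W $ m = w (Suc m) / fact m"
        by (simp add: W_def del: of_nat_Suc)
      ultimately show "real (n choose m) * (w (Suc m) * (fact (n - m) * (W ^ l) $ (n - m) / fact l))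
          = fact n / fact l * (fps_deriv W $ m * (W ^ l) $ (n - m))"
        by (simp only:) (simp add: binomial_fact)
    qed
    also have "\<dots> = fact n / fact l * (fps_deriv W * W ^ l) $ n"
      by (simp add: fps_mult_nth sum_distrib_left)
    also have "of_nat (Suc l) * (fps_deriv W * W ^ l) = fps_deriv (W ^ Suc l)"
      unfolding fps_deriv_power' by (simp add: mult.assoc)
    then have "(of_nat (Suc l) * (fps_deriv W * W ^ l)) $ n = fps_deriv (W ^ Suc l) $ n"
      by simp
    then have "real (Suc l) * (fps_deriv W * W ^ l) $ n = real (Suc n) * (W ^ Suc l) $ Suc n"
      by (simp add: fps_mult_of_nat_nth del: power_Suc of_nat_Suc)
    then have "(fps_deriv W * W ^ l) $ n = real (Suc n) * (W ^ Suc l) $ Suc n / real (Suc l)"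
      by (simp add: field_simps del: power_Suc)
    finally show ?thesis
      using fin A by (simp add: n_def W_def mult_ac del: power_Suc)
  qed
qed

text \<open>
  For \<open>r > 0\<close>, the exponential generating functions of single blocks and of single cycles with at
  least \<open>r\<close> elements: the series \<open>e^x\<close> and \<open>-log(1 - x)\<close> with the terms of degree below \<open>r\<close> removed.
  At degree \<open>0\<close> the quotient \<open>1 / real 0\<close> is \<open>0\<close>, so \<open>log_tail 0\<close> is the full series.
\<close>

definition exp_tail :: "nat \<Rightarrow> real fps" where
  "exp_tail r = Abs_fps (\<lambda>m. (if m < r then 0 else 1) / fact m)"

definition log_tail :: "nat \<Rightarrow> real fps" where
  "log_tail r = Abs_fps (\<lambda>m. if m < r then 0 else 1 / real m)"

text \<open>
  A partition of \<open>insert a A\<close> consists of the block \<open>insert a B\<close> of \<open>a\<close> and a partition of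
  \<open>A - B\<close>.
\<close>

lemma card_partition_on_insert:
  assumes "finite A" "a \<notin> A"
    and \<Phi>: "\<And>B Q. B \<subseteq> A \<Longrightarrow> partition_on (A - B) Q \<Longrightarrow> \<Phi> (insert (insert a B) Q) \<longleftrightarrow> \<Psi> B Q"
  shows "card {P. partition_on (insert a A) P \<and> \<Phi> P}
    = (\<Sum>B\<in>Pow A. card {Q. partition_on (A - B) Q \<and> \<Psi> B Q})"
proof -
  define S where "S = Sigma (Pow A) (\<lambda>B. {Q. partition_on (A - B) Q \<and> \<Psi> B Q})"
  have part: "partition_on (insert a A) (insert (insert a B) Q)"
    if "B \<subseteq> A" "partition_on (A - B) Q" for B Q
  proof -
    have "partition_on (insert a A) (insert (insert a B) Q)
        \<longleftrightarrow> partition_on (insert a A - insert a B) Q \<and> insert a B \<subseteq> insert a A \<and> insert a B \<noteq> {}"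
      using that assms(2) by (intro partition_on_insert) (auto simp: disjnt_def partition_on_def)
    moreover have "insert a A - insert a B = A - B" using assms(2) by auto
    ultimately show ?thesis using that by auto
  qed
  \<comment> \<open>The inverse recovers \<open>B\<close> from the only block that contains \<open>a\<close>.\<close>
  have inj: "inj_on (\<lambda>(B, Q). insert (insert a B) Q) S"
  proof (rule inj_on_inverseI[where g = "\<lambda>P. (\<Union>{C \<in> P. a \<in> C} - {a}, {C \<in> P. a \<notin> C})"])
    fix x assume "x \<in> S"
    then obtain B Q where x: "x = (B, Q)" "B \<subseteq> A" "partition_on (A - B) Q"
      by (auto simp: S_def)
    then have "a \<notin> B" "\<And>C. C \<in> Q \<Longrightarrow> a \<notin> C"
      using assms(2) by (auto simp: partition_on_def)
    then have "{C \<in> insert (insert a B) Q. a \<in> C} = {insert a B}"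
      "{C \<in> insert (insert a B) Q. a \<notin> C} = Q" "insert a B - {a} = B"
      by auto
    then show "(\<Union>{C \<in> case x of (B, Q) \<Rightarrow> insert (insert a B) Q. a \<in> C} - {a},
        {C \<in> case x of (B, Q) \<Rightarrow> insert (insert a B) Q. a \<notin> C}) = x"
      unfolding x(1) prod.case by simp
  qed
  have "(\<lambda>(B, Q). insert (insert a B) Q) ` S = {P. partition_on (insert a A) P \<and> \<Phi> P}"
  proof (intro equalityI subsetI)
    fix P assume "P \<in> (\<lambda>(B, Q). insert (insert a B) Q) ` S"
    then show "P \<in> {P. partition_on (insert a A) P \<and> \<Phi> P}"
      using part \<Phi> by (auto simp: S_def)
  next
    fix P assume "P \<in> {P. partition_on (insert a A) P \<and> \<Phi> P}"
    then have P: "partition_on (insert a A) P" "\<Phi> P" by auto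
    then obtain C where C: "C \<in> P" "a \<in> C" by (auto simp: partition_on_def)
    have sub: "C - {a} \<subseteq> A" using P C by (auto simp: partition_on_def)
    have eq: "insert (insert a (C - {a})) (P - {C}) = P"
      using C by (simp add: insert_absorb)
    have "disjnt C (\<Union>(P - {C}))"
      using partition_onD2[OF P(1)] C(1) by (auto simp: disjnt_def disjoint_def)
    moreover have "insert C (P - {C}) = P" using C(1) by auto
    ultimately have "partition_on (insert a A - C) (P - {C})"
      using partition_on_insert[of C "P - {C}" "insert a A"] P(1) by simp
    moreover have "insert a A - C = A - (C - {a})" using C assms(2) by auto
    ultimately have "partition_on (A - (C - {a})) (P - {C})" by simp
    then have "(C - {a}, P - {C}) \<in> S"
      using \<Phi>[OF sub, of "P - {C}"] sub P unfolding eq by (simp add: S_def)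
    then show "P \<in> (\<lambda>(B, Q). insert (insert a B) Q) ` S"
      using eq by (intro image_eqI[where x = "(C - {a}, P - {C})"]) auto
  qed
  then have "card {P. partition_on (insert a A) P \<and> \<Phi> P} = card S"
    using card_image[OF inj] by simp
  also have "\<dots> = (\<Sum>B\<in>Pow A. card {Q. partition_on (A - B) Q \<and> \<Psi> B Q})"
    unfolding S_def using assms(1)
    by (intro card_SigmaI ballI) (auto intro: finite_subset[OF _ finitely_many_partition_on])
  finally show ?thesis .
qed

lemma card_partitions_egf:
  assumes "finite A" "0 < r"
  shows "real (card {P. partition_on A P \<and> card P = l \<and> (\<forall>B\<in>P. r \<le> card B)})
    = fact (card A) * (exp_tail r ^ l) $ card A / fact l"
  unfolding exp_tail_def
proof (rule block_count_egf[where w = "\<lambda>m. if m < r then 0 else 1"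
      and N = "\<lambda>A l. real (card {P. partition_on A P \<and> card P = l \<and> (\<forall>B\<in>P. r \<le> card B)})"])
  fix A :: "'a set" assume "finite A"
  then have "{P. partition_on A P \<and> card P = 0 \<and> (\<forall>B\<in>P. r \<le> card B)} = (if A = {} then {{}} else {})"
    by (auto simp: card_eq_0_iff dest: finite_elements) (auto simp: partition_on_def)
  then show "real (card {P. partition_on A P \<and> card P = 0 \<and> (\<forall>B\<in>P. r \<le> card B)}) = (if A = {} then 1 else 0)"
    by simp
next
  show "real (card {P. partition_on {} P \<and> card P = Suc l \<and> (\<forall>B\<in>P. r \<le> card B)}) = 0" for l
    by (auto simp: partition_on_empty)
next
  fix a :: 'a and A l assume fin: "finite A" and a: "a \<notin> A"
  have "(card (insert (insert a B) Q) = Suc l \<and> (\<forall>C\<in>insert (insert a B) Q. r \<le> card C))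
      \<longleftrightarrow> (r \<le> Suc (card B) \<and> card Q = l \<and> (\<forall>C\<in>Q. r \<le> card C))"
    if "B \<subseteq> A" "partition_on (A - B) Q" for B Q
  proof -
    have "finite Q" "finite B" using that fin by (auto intro: finite_elements finite_subset)
    moreover have "insert a B \<notin> Q" "a \<notin> B" using that a by (auto simp: partition_on_def)
    ultimately show ?thesis by auto
  qed
  note step = this
  have count: "card {P. partition_on (insert a A) P \<and> card P = Suc l \<and> (\<forall>B\<in>P. r \<le> card B)}
      = (\<Sum>B\<in>Pow A. card {Q. partition_on (A - B) Q
          \<and> r \<le> Suc (card B) \<and> card Q = l \<and> (\<forall>C\<in>Q. r \<le> card C)})"
    using fin a by (rule card_partition_on_insert) (rule step)
  show "real (card {P. partition_on (insert a A) P \<and> card P = Suc l \<and> (\<forall>B\<in>P. r \<le> card B)})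
      = (\<Sum>B\<in>Pow A. (if Suc (card B) < r then 0 else 1)
          * real (card {P. partition_on (A - B) P \<and> card P = l \<and> (\<forall>B\<in>P. r \<le> card B)}))"
    unfolding count of_nat_sum by (intro sum.cong refl) auto
qed (use assms in auto)

text \<open>
  A permutation of \<open>insert a A\<close> is uniquely \<open>c \<circ> q\<close>, where \<open>c\<close> is a cyclic permutation of the
  orbit \<open>insert a B\<close> of \<open>a\<close> and \<open>q\<close> permutes \<open>A - B\<close>. The last two premises available for
  \<open>\<Phi>\<close> describe the orbits of \<open>c \<circ> q\<close>.
\<close>

lemma card_permutes_insert:
  assumes "finite A" "a \<notin> A"
    and \<Phi>: "\<And>B c q. B \<subseteq> A \<Longrightarrow> c permutes insert a B \<Longrightarrow> cyclic_on c (insert a B) \<Longrightarrow> q permutes (A - B)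
       \<Longrightarrow> (\<And>x. x \<in> insert a B \<Longrightarrow> orbit (c \<circ> q) x = insert a B)
       \<Longrightarrow> (\<And>x. x \<in> A - B \<Longrightarrow> orbit (c \<circ> q) x = orbit q x)
       \<Longrightarrow> \<Phi> (c \<circ> q) \<longleftrightarrow> \<Psi> B q"
  shows "card {p. p permutes insert a A \<and> \<Phi> p}
    = (\<Sum>B\<in>Pow A. card {c. c permutes insert a B \<and> cyclic_on c (insert a B)}
                * card {q. q permutes (A - B) \<and> \<Psi> B q})"
proof -
  define S where "S = Sigma (Pow A) (\<lambda>B. {c. c permutes insert a B \<and> cyclic_on c (insert a B)}
                \<times> {q. q permutes (A - B) \<and> \<Psi> B q})"
  have comp: "(\<forall>x\<in>insert a B. (c \<circ> q) x = c x) \<and> (\<forall>x. x \<notin> insert a B \<longrightarrow> (c \<circ> q) x = q x)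
      \<and> (\<forall>x\<in>insert a B. orbit (c \<circ> q) x = insert a B) \<and> (\<forall>x\<in>A - B. orbit (c \<circ> q) x = orbit q x)
      \<and> (c \<circ> q) permutes insert a A"
    if B: "B \<subseteq> A" and c: "c permutes insert a B" "cyclic_on c (insert a B)"
      and q: "q permutes (A - B)" for B c q
  proof -
    have 1: "(c \<circ> q) x = c x" if "x \<in> insert a B" for x
      using that assms(2) q by (auto simp: permutes_def)
    have 2: "(c \<circ> q) x = q x" if "x \<notin> insert a B" for x
    proof (cases "x \<in> A")
      case True
      then have "q x \<in> A - B" using that permutes_in_image[OF q] by auto
      then have "q x \<notin> insert a B" using assms(2) by auto
      then show ?thesis using permutes_not_in[OF c(1)] by simp
    next
      case False
      then show ?thesis using that q c B by (auto simp: permutes_def)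
    qed
    have 3: "orbit (c \<circ> q) x = insert a B" if "x \<in> insert a B" for x
    proof -
      have "cyclic_on (c \<circ> q) (insert a B)"
        using c(2) 1 cyclic_cong[of "insert a B" "c \<circ> q" c] by blast
      then show ?thesis using that by (rule orbit_cyclic_eq3)
    qed
    have 4: "orbit (c \<circ> q) x = orbit q x" if x: "x \<in> A - B" for x
    proof (rule orbit_cong)
      show "x \<in> orbit q x"
        using q assms(1) by (intro permutation_self_in_orbit) (auto simp: permutation_permutes)
      show "(c \<circ> q) s = q s" if "s \<in> orbit q x" for s
        using that permutes_orbit_subset[OF q x] assms(2) by (intro 2) auto
    qed
    have "c permutes insert a A" "q permutes insert a A"
      using c q B by (auto intro: permutes_subset)
    then have 5: "(c \<circ> q) permutes insert a A" by (rule permutes_compose[rotated])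
    show ?thesis using 1 2 3 4 5 by blast
  qed
  have iff: "\<Phi> (c \<circ> q) \<longleftrightarrow> \<Psi> B q"
    if "B \<subseteq> A" "c permutes insert a B" "cyclic_on c (insert a B)" "q permutes (A - B)" for B c q
    using that comp[OF that] by (intro \<Phi>) blast+
  have inj: "inj_on (\<lambda>(B, c, q). c \<circ> q) S"
  proof (rule inj_onI)
    fix u v
    assume uv: "u \<in> S" "v \<in> S" and eq': "(\<lambda>(B, c, q). c \<circ> q) u = (\<lambda>(B, c, q). c \<circ> q) v"
    obtain B c q B' c' q' where u: "u = (B, c, q)" and v: "v = (B', c', q')"
      by (metis prod_cases3)
    have eq: "c \<circ> q = c' \<circ> q'" using eq' by (simp add: u v)
    from uv have dec: "B \<subseteq> A" "c permutes insert a B" "cyclic_on c (insert a B)" "q permutes (A - B)"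
      and dec': "B' \<subseteq> A" "c' permutes insert a B'" "cyclic_on c' (insert a B')" "q' permutes (A - B')"
      by (auto simp: S_def u v)
    have "insert a B = orbit (c \<circ> q) a" using comp[OF dec] by blast
    also have "\<dots> = insert a B'" unfolding eq using comp[OF dec'] by blast
    finally have BB: "B = B'" using dec(1) dec'(1) assms(2) by auto
    have "c x = c' x" for x
    proof (cases "x \<in> insert a B")
      case True
      then show ?thesis using comp[OF dec] comp[OF dec'] eq BB by metis
    next
      case False
      then show ?thesis using dec(2) dec'(2) BB by (simp add: permutes_def)
    qed
    moreover have "q x = q' x" for x
    proof (cases "x \<in> insert a B")
      case False
      then show ?thesis using comp[OF dec] comp[OF dec'] eq BB by metis
    next
      case True
      then have "x \<notin> A - B" using assms(2) by auto
      then show ?thesis using dec(4) dec'(4) BB by (simp add: permutes_def)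
    qed
    ultimately show "u = v" using BB by (auto simp: u v)
  qed
  have "(\<lambda>(B, c, q). c \<circ> q) ` S = {p. p permutes insert a A \<and> \<Phi> p}"
  proof (intro equalityI subsetI)
    fix p assume "p \<in> (\<lambda>(B, c, q). c \<circ> q) ` S"
    then obtain B c q where dec: "B \<subseteq> A" "c permutes insert a B" "cyclic_on c (insert a B)" "q permutes (A - B)"
      and "\<Psi> B q" "p = c \<circ> q" by (auto simp: S_def)
    with comp[OF dec] iff[OF dec] show "p \<in> {p. p permutes insert a A \<and> \<Phi> p}" by auto
  next
    fix p assume "p \<in> {p. p permutes insert a A \<and> \<Phi> p}"
    then have p: "p permutes insert a A" "\<Phi> p" by auto
    define B where "B = orbit p a - {a}"
    define c where "c = perm_restrict p (insert a B)"
    define q where "q = perm_restrict p (A - B)"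
    have orb: "orbit p a = insert a B"
      using p(1) assms(1) unfolding B_def
      by (metis finite_insert insert_Diff permutation_permutes permutation_self_in_orbit)
    have cyc: "cyclic_on p (insert a B)"
      using cyclic_on_orbit[OF p(1)] assms(1) orb by (metis finite_insert)
    have B: "B \<subseteq> A"
      using permutes_orbit_subset[OF p(1), of a] unfolding B_def by auto
    have eq: "insert a A - insert a B = A - B" using assms(2) by auto
    have q: "q permutes (A - B)"
      using perm_restrict_diff_cyclic[OF p(1) cyc] unfolding eq q_def .
    have cyc': "cyclic_on c (insert a B)"
      using cyc unfolding c_def cyclic_on_perm_restrict .
    have c: "c permutes insert a B"
    proof (rule bij_imp_permutes)
      have "finite (insert a B)" using cyc by (rule finite_cyclic_on)
      moreover have "c ` insert a B \<subseteq> insert a B" using cyclic_on_inI[OF cyc'] by blast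
      moreover have "inj_on c (insert a B)"
        using permutes_inj[OF p(1)] by (auto simp: c_def perm_restrict_def inj_on_def)
      ultimately show "bij_betw c (insert a B) (insert a B)"
        using endo_inj_surj[of "insert a B" c] unfolding bij_betw_def by blast
      show "c x = x" if "x \<notin> insert a B" for x
        using that by (simp add: c_def perm_restrict_simps)
    qed
    have pcq: "p = c \<circ> q"
    proof
      fix x
      show "p x = (c \<circ> q) x"
      proof (cases "x \<in> insert a B")
        case True
        then have "(c \<circ> q) x = c x" using comp[OF B c cyc' q] by blast
        then show ?thesis using True by (simp add: c_def perm_restrict_simps)
      next
        case False
        then have "(c \<circ> q) x = q x" using comp[OF B c cyc' q] by blast
        then show ?thesis
          using False p(1) by (auto simp: q_def perm_restrict_def permutes_def)
      qed
    qed
    have "\<Psi> B q"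
      using iff[OF B c cyc' q] p(2) pcq by blast
    then have "(B, c, q) \<in> S" using B c cyc' q by (simp add: S_def)
    then show "p \<in> (\<lambda>(B, c, q). c \<circ> q) ` S" using pcq by force
  qed
  then have "card {p. p permutes insert a A \<and> \<Phi> p} = card S"
    using card_image[OF inj] by simp
  also have "\<dots> = (\<Sum>B\<in>Pow A. card ({c. c permutes insert a B \<and> cyclic_on c (insert a B)}
                \<times> {q. q permutes (A - B) \<and> \<Psi> B q}))"
    unfolding S_def using assms(1)
  proof (intro card_SigmaI ballI finite_cartesian_product)
    fix B assume "B \<in> Pow A"
    then have "finite (insert a B)" "finite (A - B)"
      using assms(1) by (auto intro: finite_subset)
    then show "finite {c. c permutes insert a B \<and> cyclic_on c (insert a B)}"
      "finite {q. q permutes (A - B) \<and> \<Psi> B q}"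
      by (auto intro: finite_subset[OF _ finite_permutations])
  qed (use assms(1) in simp)
  finally show ?thesis by (simp add: card_cartesian_product)
qed

text \<open>
  The decomposition above, applied to all permutations of a set with \<open>n + 1\<close> elements, gives
  \<open>(n + 1)!\<close> as the sum of \<open>(n choose m) z(m) (n - m)!\<close> over \<open>m \<le> n\<close>, where \<open>z(m)\<close> is the number
  of cyclic permutations of \<open>m + 1\<close> elements. By induction the terms with \<open>m < n\<close> are all \<open>n!\<close>,
  which leaves \<open>z(n) = n!\<close>.
\<close>

lemma card_cyclic_permutations:
  assumes "finite A" "a \<notin> A"
  shows "card {c. c permutes insert a A \<and> cyclic_on c (insert a A)} = fact (card A)"
  using assms
proof (induction "card A" arbitrary: A rule: less_induct)
  case less
  define n where "n = card A"
  define cyc where "cyc B = card {c. c permutes insert a B \<and> cyclic_on c (insert a B)}" for B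
  have "card {p. p permutes insert a A \<and> True}
    = (\<Sum>B\<in>Pow A. cyc B * card {q. q permutes (A - B) \<and> True})"
    unfolding cyc_def using less.prems by (rule card_permutes_insert) auto
  also have "\<dots> = (\<Sum>B\<in>Pow A. cyc B * fact (n - card B))"
  proof (intro sum.cong refl)
    fix B assume "B \<in> Pow A"
    then have "card {q. q permutes (A - B) \<and> True} = fact (n - card B)"
      using less.prems card_permutations[of "A - B" "card (A - B)"]
      by (simp add: n_def card_Diff_subset finite_subset)
    then show "cyc B * card {q. q permutes (A - B) \<and> True} = cyc B * fact (n - card B)" by simp
  qed
  also have "\<dots> = cyc A + (\<Sum>B\<in>Pow A - {A}. cyc B * fact (n - card B))"
    using less.prems(1) by (subst sum.remove[of _ A]) (auto simp: n_def)
  also have "(\<Sum>B\<in>Pow A - {A}. cyc B * fact (n - card B))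
      = (\<Sum>B\<in>Pow A - {A}. fact (card B) * fact (n - card B))"
  proof (intro sum.cong refl)
    fix B assume B: "B \<in> Pow A - {A}"
    then have "card B < card A" using less.prems(1) by (auto intro: psubset_card_mono)
    then have "cyc B = fact (card B)"
      unfolding cyc_def using B less.prems by (intro less.hyps) (auto intro: finite_subset)
    then show "cyc B * fact (n - card B) = fact (card B) * fact (n - card B)" by simp
  qed
  finally have "cyc A + (\<Sum>B\<in>Pow A - {A}. fact (card B) * fact (n - card B)) = fact (Suc n)"
    using less.prems card_permutations[of "insert a A" "Suc n"] by (simp add: n_def)
  moreover have "fact n + (\<Sum>B\<in>Pow A - {A}. fact (card B) * fact (n - card B)) = (fact (Suc n) :: nat)"
  proof -
    have "fact n + (\<Sum>B\<in>Pow A - {A}. fact (card B) * fact (n - card B))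
        = (\<Sum>B\<in>Pow A. fact (card B) * fact (n - card B) :: nat)"
      using less.prems(1) by (subst (2) sum.remove[of _ A]) (auto simp: n_def)
    also have "\<dots> = (\<Sum>m=0..n. (n choose m) * (fact m * fact (n - m)))"
      using sum_Pow_card[OF less.prems(1), of "\<lambda>m. fact m * fact (n - m) :: nat"] by (simp add: n_def)
    also have "\<dots> = (\<Sum>m=0..n. fact n)"
    proof (intro sum.cong refl)
      fix m assume "m \<in> {0..n}"
      then show "(n choose m) * (fact m * fact (n - m)) = fact n"
        using binomial_fact_lemma[of m n] by (simp add: mult_ac)
    qed
    finally show ?thesis by simp
  qed
  ultimately show ?case by (simp add: n_def cyc_def)
qed

lemma log_tail_altdef:
  "0 < r \<Longrightarrow> log_tail r = Abs_fps (\<lambda>m. (if m < r then 0 else fact (m - 1)) / fact m)"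
  by (intro fps_ext) (auto simp: log_tail_def fact_reduce)

text \<open>
  The weight of a cycle with \<open>m\<close> elements is the number \<open>(m - 1)!\<close> of cyclic permutations of
  its elements, so the cycles with at least \<open>r\<close> elements have the generating function
  \<open>log_tail r\<close>.
\<close>

lemma card_permutations_egf:
  assumes "finite A" "0 < r"
  shows "real (card {p. p permutes A \<and> card (orbit p ` A) = l \<and> (\<forall>x\<in>A. r \<le> card (orbit p x))})
    = fact (card A) * (log_tail r ^ l) $ card A / fact l"
  unfolding log_tail_altdef[OF \<open>0 < r\<close>]
proof (rule block_count_egf[where w = "\<lambda>m. if m < r then 0 else fact (m - 1)"
      and N = "\<lambda>A l. real (card {p. p permutes A \<and> card (orbit p ` A) = l \<and> (\<forall>x\<in>A. r \<le> card (orbit p x))})"])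
  fix A :: "'a set" assume "finite A"
  then have "{p. p permutes A \<and> card (orbit p ` A) = 0 \<and> (\<forall>x\<in>A. r \<le> card (orbit p x))}
      = (if A = {} then {id} else {})"
    by auto
  then show "real (card {p. p permutes A \<and> card (orbit p ` A) = 0 \<and> (\<forall>x\<in>A. r \<le> card (orbit p x))})
      = (if A = {} then 1 else 0)"
    by simp
next
  fix a :: 'a and A l assume fin: "finite A" and a: "a \<notin> A"
  have "(card (orbit (c \<circ> q) ` insert a A) = Suc l \<and> (\<forall>x\<in>insert a A. r \<le> card (orbit (c \<circ> q) x)))
      \<longleftrightarrow> (r \<le> Suc (card B) \<and> card (orbit q ` (A - B)) = l \<and> (\<forall>x\<in>A - B. r \<le> card (orbit q x)))"
    if B: "B \<subseteq> A" and q: "q permutes (A - B)"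
      and 1: "\<And>x. x \<in> insert a B \<Longrightarrow> orbit (c \<circ> q) x = insert a B"
      and 2: "\<And>x. x \<in> A - B \<Longrightarrow> orbit (c \<circ> q) x = orbit q x" for B c q
  proof -
    have split: "insert a A = insert a B \<union> (A - B)" using B by auto
    have img1: "orbit (c \<circ> q) ` (insert a B) = {insert a B}" using 1 by auto
    have img2: "orbit (c \<circ> q) ` (A - B) = orbit q ` (A - B)"
      using 2 by (intro image_cong) auto
    have "orbit (c \<circ> q) ` insert a A = insert (insert a B) (orbit q ` (A - B))"
      unfolding split image_Un img1 img2 by simp
    moreover have "insert a B \<notin> orbit q ` (A - B)"
      using permutes_orbit_subset[OF q] a by blast
    ultimately have "card (orbit (c \<circ> q) ` insert a A) = Suc (card (orbit q ` (A - B)))"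
      using fin by simp
    moreover have "card (insert a B) = Suc (card B)"
      using B a fin by (meson card_insert_disjoint finite_subset subsetD)
    moreover have "(\<forall>x\<in>insert a A. r \<le> card (orbit (c \<circ> q) x))
        \<longleftrightarrow> r \<le> card (insert a B) \<and> (\<forall>x\<in>A - B. r \<le> card (orbit q x))"
      unfolding split ball_Un using 1 2 by auto
    ultimately show ?thesis by auto
  qed
  note step = this
  have cyc: "card {c. c permutes insert a B \<and> cyclic_on c (insert a B)} = fact (card B)" if "B \<in> Pow A" for B
    using that a fin by (intro card_cyclic_permutations) (auto intro: finite_subset)
  have "card {p. p permutes insert a A \<and> card (orbit p ` insert a A) = Suc l
            \<and> (\<forall>x\<in>insert a A. r \<le> card (orbit p x))}
      = (\<Sum>B\<in>Pow A. card {c. c permutes insert a B \<and> cyclic_on c (insert a B)}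
          * card {q. q permutes (A - B) \<and> r \<le> Suc (card B) \<and> card (orbit q ` (A - B)) = l
              \<and> (\<forall>x\<in>A - B. r \<le> card (orbit q x))})"
    using fin a by (rule card_permutes_insert) (rule step)
  then show "real (card {p. p permutes insert a A \<and> card (orbit p ` insert a A) = Suc l
            \<and> (\<forall>x\<in>insert a A. r \<le> card (orbit p x))})
      = (\<Sum>B\<in>Pow A. (if Suc (card B) < r then 0 else fact (Suc (card B) - 1))
          * real (card {q. q permutes (A - B) \<and> card (orbit q ` (A - B)) = l
              \<and> (\<forall>x\<in>A - B. r \<le> card (orbit q x))}))"
    by (simp only: of_nat_sum, intro sum.cong refl) (auto simp: cyc)
qed (use assms in auto)

section \<open>Residues of formal power series\<close>

text \<open>
  With \<open>w = x V\<close>, the coefficient is the residue of \<open>w^(-n-1) dw\<close>. For \<open>n > 0\<close> this is the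
  exact form \<open>d(-w^(-n) / n)\<close>, which has no residue.
\<close>

lemma fps_residue_power_deriv:
  fixes V :: "'a::field_char_0 fps"
  assumes "V $ 0 \<noteq> 0"
  shows "(inverse V ^ Suc n * fps_deriv (fps_X * V)) $ n = (if n = 0 then 1 else 0)"
proof -
  define J where "J = inverse V"
  have JV: "J * V = 1"
    using assms by (simp add: J_def inverse_mult_eq_1)
  have J': "fps_deriv J = - fps_deriv V * J ^ 2"
    using assms by (simp add: J_def fps_inverse_deriv)
  have "J ^ Suc n * fps_deriv (fps_X * V) = J ^ n * (J * V) + fps_X * (J ^ Suc n * fps_deriv V)"
    by (simp add: algebra_simps)
  then have eq: "J ^ Suc n * fps_deriv (fps_X * V) = J ^ n + fps_X * (J ^ Suc n * fps_deriv V)"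
    by (simp add: JV)
  show ?thesis
  proof (cases n)
    case 0
    then show ?thesis using eq by (simp add: J_def)
  next
    case (Suc m)
    have "fps_deriv (J ^ n) = of_nat n * fps_deriv J * J ^ m"
      unfolding Suc fps_deriv_power' by simp
    also have "\<dots> = - of_nat n * (J ^ Suc n * fps_deriv V)"
      by (simp add: J' Suc power2_eq_square algebra_simps)
    finally have "fps_deriv (J ^ n) $ m = (- of_nat n * (J ^ Suc n * fps_deriv V)) $ m"
      by simp
    then have "of_nat n * (J ^ n) $ n = - of_nat n * (J ^ Suc n * fps_deriv V) $ m"
      by (simp add: Suc fps_mult_of_nat_nth flip: fps_of_nat fps_const_neg del: power_Suc of_nat_Suc)
    then have "(J ^ n) $ n + (J ^ Suc n * fps_deriv V) $ m = 0"
      by (simp add: Suc del: power_Suc of_nat_Suc flip: distrib_left mult_minus_right)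
    then show ?thesis
      using eq Suc by (simp flip: J_def del: power_Suc)
  qed
qed

text \<open>
  Change of variables for residues: with \<open>w = x V\<close>, both sides are the residue of
  \<open>H(w) w^(-n-1) dw\<close>, computed in \<open>x\<close> and in \<open>w\<close>.
\<close>

lemma fps_residue_compose:
  fixes H V :: "'a::field_char_0 fps"
  assumes "V $ 0 \<noteq> 0"
  shows "((H oo (fps_X * V)) * fps_deriv (fps_X * V) * inverse V ^ Suc n) $ n = H $ n"
proof -
  define w where "w = fps_X * V"
  define Q where "Q = fps_deriv w * inverse V ^ Suc n"
  have low: "(w ^ m) $ i = 0" if "i < m" for m i
    using that by (simp add: w_def power_mult_distrib fps_X_power_mult_nth)
  have comp: "(H oo w) $ i = (\<Sum>m=0..n. H $ m * (w ^ m) $ i)" if "i \<le> n" for i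
    unfolding fps_compose_nth by (rule sum.mono_neutral_left) (use that low in auto)
  have coeff: "(w ^ m * Q) $ n = (if m = n then 1 else 0)" if "m \<le> n" for m
  proof -
    have "V ^ m * inverse V ^ Suc n = (V * inverse V) ^ m * inverse V ^ Suc (n - m)"
      using that by (simp add: power_mult_distrib mult.assoc Suc_diff_le flip: power_add power_Suc)
    then have "w ^ m * Q = fps_X ^ m * (inverse V ^ Suc (n - m) * fps_deriv w)"
      using assms
      by (simp add: w_def Q_def power_mult_distrib inverse_mult_eq_1' mult_ac del: power_Suc)
    then have "(w ^ m * Q) $ n = (inverse V ^ Suc (n - m) * fps_deriv w) $ (n - m)"
      using that by (simp add: fps_X_power_mult_nth del: power_Suc)
    then show ?thesis
      using fps_residue_power_deriv[OF assms, of "n - m"] that by (auto simp: w_def)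
  qed
  have "((H oo w) * Q) $ n = (\<Sum>i=0..n. (\<Sum>m=0..n. H $ m * (w ^ m) $ i) * Q $ (n - i))"
    unfolding fps_mult_nth by (intro sum.cong refl) (simp add: comp)
  also have "\<dots> = (\<Sum>m=0..n. H $ m * (w ^ m * Q) $ n)"
    unfolding fps_mult_nth sum_distrib_left sum_distrib_right
    by (subst sum.swap) (simp add: mult.assoc)
  also have "\<dots> = (\<Sum>m=0..n. if m = n then H $ m else 0)"
    by (intro sum.cong refl) (simp add: coeff)
  also have "\<dots> = H $ n"
    by simp
  finally show ?thesis
    by (simp add: Q_def w_def mult_ac)
qed

section \<open>Inverse square roots and the alternating sums\<close>

text \<open>
  The inverse square root of \<open>1 + Z\<close> as a binomial series; it is meaningful for \<open>Z $ 0 = 0\<close>.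
\<close>

definition inv_sqrt :: "real fps \<Rightarrow> real fps" where
  "inv_sqrt Z = fps_binomial (- 1 / 2) oo Z"

lemma inv_sqrt_nth_0 [simp]: "inv_sqrt Z $ 0 = 1"
  by (simp add: inv_sqrt_def)

lemma inv_sqrt_square:
  assumes "Z $ 0 = 0"
  shows "inv_sqrt Z ^ 2 * (1 + Z) = 1"
proof -
  have "fps_binomial (- 1 / 2 :: real) ^ 2 * (1 + fps_X) = 1"
    by (simp add: fps_binomial_power fps_binomial_minus_one inverse_mult_eq_1)
  then have "(fps_binomial (- 1 / 2 :: real) ^ 2 * (1 + fps_X)) oo Z = 1"
    by simp
  then show ?thesis
    using assms
    by (simp add: inv_sqrt_def fps_compose_mult_distrib fps_compose_add_distrib
        fps_compose_power)
qed

lemma inv_sqrt_power: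
  assumes "Z $ 0 = 0"
  shows "inv_sqrt Z ^ k = fps_binomial (- real k / 2) oo Z"
  using assms by (simp add: inv_sqrt_def fps_compose_power fps_binomial_power)

lemma fact_eq_pochhammer_mult_prod:
  assumes "k > 0"
  shows "fact (k + 2 * j - 1)
    = (fact (k - 1) * 2 ^ j * pochhammer (real k / 2) j * (\<Prod>i=1..j. real (k + 2 * i - 1)) :: real)"
proof (induction j)
  case (Suc j)
  obtain k' where k: "k = Suc k'"
    using assms by (cases k) auto
  have "fact (k + 2 * Suc j - 1)
      = (real k + 2 * real j + 1) * (real k + 2 * real j) * fact (k + 2 * j - 1)"
    by (simp add: k algebra_simps)
  also have "\<dots> = fact (k - 1) * 2 ^ Suc j * (pochhammer (real k / 2) j * (real k / 2 + real j))
      * ((\<Prod>i=1..j. real (k + 2 * i - 1)) * (real k + 2 * real j + 1))"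
  proof -
    have "(c + 1) * c * (F * T * p * Q) = F * (2 * T) * (p * (c / 2)) * (Q * (c + 1))"
      for c F T p Q :: real
      by (simp add: mult_ac)
    from this[of "real k + 2 * real j"] show ?thesis
      unfolding Suc.IH power_Suc by (simp only: add_divide_distrib) simp
  qed
  also have "real k + 2 * real j + 1 = real (k + 2 * Suc j - 1)"
    by (simp add: k)
  finally show ?case
    by (simp add: pochhammer_Suc)
qed auto

text \<open>
  The sum is a truncated binomial series. Its terms with \<open>j \<ge> k\<close> would vanish because \<open>Z^j\<close> has
  no term of degree below \<open>j\<close>, so truncation at \<open>k - 1\<close> loses nothing.
\<close>

lemma alternating_sum_eq_inv_sqrt_coeff:
  fixes f Z :: "real fps"
  assumes "k > 0" and Z0: "Z $ 0 = 0" and f: "2 * f = fps_X ^ 2 * Z"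
  shows "(\<Sum>j=0..k-1. (-1) ^ j * (fact (k + 2*j - 1) * (f ^ j) $ (k + 2*j - 1) / fact j)
            / (\<Prod>i=1..j. real (k + 2*i - 1)))
       = fact (k - 1) * (inv_sqrt Z ^ k) $ (k - 1)"
proof -
  have "(-1) ^ j * (fact (k + 2*j - 1) * (f ^ j) $ (k + 2*j - 1) / fact j)
            / (\<Prod>i=1..j. real (k + 2*i - 1))
        = fact (k - 1) * (((- real k / 2) gchoose j) * (Z ^ j) $ (k - 1))" for j
  proof -
    have "2 ^ j * f ^ j = fps_X ^ (2 * j) * Z ^ j"
      using f by (metis power_mult_distrib power_mult)
    then have "(2 ^ j * f ^ j) $ (k + 2*j - 1) = (Z ^ j) $ (k - 1)"
      using \<open>k > 0\<close> by (simp add: fps_X_power_mult_nth)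
    then have fj: "2 ^ j * (f ^ j) $ (k + 2*j - 1) = (Z ^ j) $ (k - 1)"
      by (simp add: numeral_fps_const)
    have pos: "(\<Prod>i=1..j. real (k + 2*i - 1)) \<noteq> 0"
      using \<open>k > 0\<close> by auto
    have "(-1) ^ j * (fact (k + 2*j - 1) * (f ^ j) $ (k + 2*j - 1) / fact j)
            / (\<Prod>i=1..j. real (k + 2*i - 1))
        = (-1) ^ j * fact (k - 1) * pochhammer (real k / 2) j / fact j
            * (2 ^ j * (f ^ j) $ (k + 2*j - 1))"
      unfolding fact_eq_pochhammer_mult_prod[OF \<open>k > 0\<close>] using pos by (simp add: field_simps)
    also have "\<dots> = fact (k - 1) * (((- real k / 2) gchoose j) * (Z ^ j) $ (k - 1))"
      unfolding fj by (simp add: gbinomial_pochhammer)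
    finally show ?thesis .
  qed
  then show ?thesis
    by (simp add: inv_sqrt_power[OF Z0] fps_compose_nth sum_distrib_left)
qed

section \<open>The substitution relating exponential and logarithm\<close>

text \<open>
  This is the identity \<open>-log(1 - u) = -x\<close> for \<open>u = 1 - e^x\<close>. The constant coefficient
  \<open>1 / real 0\<close> of the logarithmic series is \<open>0\<close>.
\<close>

lemma fps_log_compose:
  "Abs_fps (\<lambda>n. 1 / real n) oo (1 - fps_exp 1) = - fps_X"
proof -
  define L where "L = Abs_fps (\<lambda>n. 1 / real n)"
  define w :: "real fps" where "w = 1 - fps_exp 1"
  have w0: "w $ 0 = 0" by (simp add: w_def)
  have "fps_deriv L * (1 - fps_X) = 1"
    by (rule fps_ext) (auto simp: L_def algebra_simps)
  then have "(fps_deriv L * (1 - fps_X)) oo w = 1"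
    by simp
  then have "(fps_deriv L oo w) * (1 - w) = 1"
    using w0 by (simp add: fps_compose_mult_distrib fps_compose_sub_distrib)
  moreover have "fps_deriv (L oo w) = - ((fps_deriv L oo w) * (1 - w))"
    using w0 by (simp add: fps_compose_deriv) (simp add: w_def)
  ultimately have "fps_deriv (L oo w) = fps_deriv (- fps_X)"
    by simp
  then have "L oo w = fps_const ((L oo w) $ 0 - (- fps_X) $ 0) + - fps_X"
    unfolding fps_deriv_eq_iff .
  then show ?thesis
    by (simp add: L_def w_def)
qed

text \<open>
  In the notation of the introduction, \<open>A = inv_sqrt Zf\<close>, \<open>B = inv_sqrt Zg\<close>, and \<open>w\<close> is the
  substituted series \<open>u = 1 - e^x = -x E\<close>. The premise \<open>k \<noteq> 2\<close> makes \<open>Y^(1-k) dY\<close> exact.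
\<close>

lemma inv_sqrt_coeff_exp_eq_log:
  fixes Zf Zg :: "real fps"
  assumes "k > 0" "k \<noteq> 2" and Zf0: "Zf $ 0 = 0" and Zg0: "Zg $ 0 = 0"
    and f: "2 * exp_tail 3 = fps_X ^ 2 * Zf" and g: "2 * log_tail 3 = fps_X ^ 2 * Zg"
  shows "(inv_sqrt Zf ^ k) $ (k - 1) = (- 1) ^ (k - 1) * (inv_sqrt Zg ^ k) $ (k - 1)"
proof -
  define A where "A = inv_sqrt Zf"
  define B where "B = inv_sqrt Zg"
  define E :: "real fps" where "E = fps_shift 1 (fps_exp 1)"
  define w :: "real fps" where "w = fps_X * (- E)"
  have E0: "E $ 0 = 1" by (simp add: E_def)
  have w_eq: "w = 1 - fps_exp 1"
    by (rule fps_ext) (simp add: w_def E_def)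
  have w0: "w $ 0 = 0" by (simp add: w_def)
  have F: "fps_X ^ 2 * (1 + Zf) = 2 * (fps_exp 1 - 1 - fps_X)"
    unfolding distrib_left f[symmetric] exp_tail_def
    by (rule fps_ext) (auto simp: numeral_fps_const fps_X_power_nth less_Suc_eq numeral_3_eq_3 numeral_2_eq_2)
  have G: "fps_X ^ 2 * (1 + Zg) = 2 * (Abs_fps (\<lambda>n. 1 / real n) - fps_X)"
    unfolding distrib_left g[symmetric] log_tail_def
    by (rule fps_ext) (auto simp: numeral_fps_const fps_X_power_nth less_Suc_eq numeral_3_eq_3 numeral_2_eq_2)
  have "w ^ 2 * (1 + (Zg oo w)) = (fps_X ^ 2 * (1 + Zg)) oo w"
    using w0 by (simp add: fps_compose_mult_distrib fps_compose_add_distrib fps_compose_power[symmetric])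
  also have "\<dots> = 2 * (- fps_X - w)"
    unfolding G using w0
    by (simp add: fps_compose_mult_distrib fps_compose_sub_distrib numeral_fps_const
        fps_log_compose[folded w_eq])
  also have "\<dots> = fps_X ^ 2 * (1 + Zf)"
    unfolding F by (simp add: w_eq)
  finally have EG: "E ^ 2 * (1 + (Zg oo w)) = 1 + Zf"
    by (simp add: w_def power_mult_distrib mult.assoc)
  have Bw: "B oo w = inv_sqrt (Zg oo w)"
    using w0 Zg0 by (simp add: B_def inv_sqrt_def fps_compose_assoc)
  have AF: "A ^ 2 * (1 + Zf) = 1"
    unfolding A_def by (rule inv_sqrt_square[OF Zf0])
  have "(B oo w) ^ 2 * (1 + (Zg oo w)) = 1"
    unfolding Bw by (rule inv_sqrt_square) (simp add: Zg0)
  then have "(B oo w) ^ 2 = (A * E) ^ 2"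
    using AF EG by algebra
  \<comment> \<open>A square root is determined up to sign, and the constant coefficient fixes the sign.\<close>
  then have "B oo w = A * E \<or> B oo w = - (A * E)"
    by (simp add: power2_eq_iff)
  moreover have "(B oo w) $ 0 = 1" "(- (A * E)) $ 0 = - 1"
    by (simp_all add: Bw A_def E0)
  ultimately have BAE: "B oo w = A * E"
    by (metis one_neq_neg_one)
  obtain n where k: "k = Suc n"
    using \<open>k > 0\<close> by (cases k) auto
  have EI: "E * inverse E = 1"
    using E0 by (simp add: inverse_mult_eq_1')
  have dw: "fps_deriv w = - fps_exp 1"
    by (simp add: w_eq)
  have "(B ^ k) $ n = ((B ^ k oo w) * fps_deriv w * inverse (- E) ^ k) $ n"
    unfolding w_def k by (rule fps_residue_compose[symmetric]) (simp add: E0)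
  also have "B ^ k oo w = (B oo w) ^ k"
    using w0 by (simp add: fps_compose_power)
  also have "((B oo w) ^ k) * fps_deriv w * inverse (- E) ^ k
      = (-1) ^ n * (A ^ k * fps_exp 1) * (E * inverse E) ^ k"
    unfolding BAE dw fps_inverse_minus
    by (simp add: k power_mult_distrib power_minus[of "inverse E"])
  also have "\<dots> = (-1) ^ n * (A ^ k * fps_exp 1)"
    by (simp add: EI)
  also have "\<dots> $ n = (-1) ^ n * (A ^ k * fps_exp 1) $ n"
    by (cases "even n") simp_all
  finally have Bk: "(B ^ k) $ n = (-1) ^ n * (A ^ k * fps_exp 1) $ n" .
  \<comment> \<open>With \<open>V = 1/A\<close> and \<open>Y = x V\<close>, the coefficient is the residue of \<open>Y^(1-k) dY\<close>.\<close>
  have "(A ^ k * (fps_exp 1 - 1)) $ n = 0"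
  proof -
    define V where "V = inverse A"
    have AV: "A * V = 1"
      by (simp add: V_def A_def inverse_mult_eq_1')
    have V0: "V $ 0 = 1" by (simp add: V_def A_def)
    have "V ^ 2 = 1 + Zf"
      using AF AV by algebra
    then have "(fps_X * V) ^ 2 = 2 * (fps_exp 1 - 1 - fps_X)"
      using F by (simp add: power_mult_distrib)
    then have "fps_deriv ((fps_X * V) ^ 2) = 2 * (fps_exp 1 - 1)"
      by simp
    then have "2 * (fps_X * V * fps_deriv (fps_X * V)) = 2 * (fps_exp 1 - 1)"
      by (simp only: fps_deriv_power') (simp add: mult_ac)
    then have "fps_exp 1 - 1 = fps_X * V * fps_deriv (fps_X * V)"
      by (metis mult_left_cancel zero_neq_numeral)
    then have "A ^ k * (fps_exp 1 - 1) = fps_X * (A ^ n * fps_deriv (fps_X * V)) * (A * V)"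
      by (simp add: k algebra_simps del: fps_deriv_mult)
    then have *: "A ^ k * (fps_exp 1 - 1) = fps_X * (A ^ n * fps_deriv (fps_X * V))"
      by (simp add: AV)
    have AI: "A = inverse V" by (simp add: V_def A_def)
    show ?thesis
    proof (cases n)
      case (Suc m)
      then have "m \<noteq> 0" using \<open>k \<noteq> 2\<close> k by auto
      then show ?thesis
        using fps_residue_power_deriv[of V m] V0
        by (simp add: * Suc flip: AI del: power_Suc fps_deriv_mult)
    qed (simp add: *)
  qed
  then have "(A ^ k * fps_exp 1) $ n = (A ^ k) $ n"
    by (simp add: algebra_simps)
  then show ?thesis
    using Bk by (simp add: k A_def B_def flip: power_mult_distrib mult.assoc)
qed

theorem proposition3p2:
  fixes k :: nat
  assumes "k > 0" and "k \<noteq> 2"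
  shows "(\<Sum>j=0..k-1. (-1) ^ j * real (S3 (k + 2*j - 1) j) / (\<Prod>i=1..j. real (k + 2*i - 1)))
       = (\<Sum>j=0..k-1. (-1) ^ (k + j - 1) * real (d3 (k + 2*j - 1) j) / (\<Prod>i=1..j. real (k + 2*i - 1)))"
proof -
  define Zf where "Zf = fps_shift 2 (2 * exp_tail 3)"
  define Zg where "Zg = fps_shift 2 (2 * log_tail 3)"
  have shift: "F = fps_X ^ 2 * fps_shift 2 F" if "\<And>n. n < 2 \<Longrightarrow> F $ n = 0" for F :: "real fps"
    by (rule fps_ext)
       (auto simp: that fps_X_power_mult_nth intro!: arg_cong[where f = "fps_nth F"])
  have f: "2 * exp_tail 3 = fps_X ^ 2 * Zf"
    unfolding Zf_def by (rule shift) (simp add: exp_tail_def numeral_fps_const)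
  have g: "2 * log_tail 3 = fps_X ^ 2 * Zg"
    unfolding Zg_def by (rule shift) (simp add: log_tail_def numeral_fps_const)
  have Zf0: "Zf $ 0 = 0" and Zg0: "Zg $ 0 = 0"
    by (simp_all add: Zf_def Zg_def exp_tail_def log_tail_def numeral_fps_const)
  have S3: "real (S3 n l) = fact n * (exp_tail 3 ^ l) $ n / fact l" for n l
    using card_partitions_egf[of "{..<n}" 3 l] by (simp add: S3_def)
  have d3: "real (d3 n l) = fact n * (log_tail 3 ^ l) $ n / fact l" for n l
    using card_permutations_egf[of "{..<n}" 3 l] by (simp add: d3_def)
  have sign: "(-1) ^ (k + j - 1) = (-1) ^ (k - 1) * ((-1) ^ j :: real)" for j
    using \<open>k > 0\<close> by (simp flip: power_add)
  have "(\<Sum>j=0..k-1. (-1) ^ j * real (S3 (k + 2*j - 1) j) / (\<Prod>i=1..j. real (k + 2*i - 1)))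
      = fact (k - 1) * (inv_sqrt Zf ^ k) $ (k - 1)"
    unfolding S3 by (rule alternating_sum_eq_inv_sqrt_coeff[OF \<open>k > 0\<close> Zf0 f])
  also have "\<dots> = (-1) ^ (k - 1) * (fact (k - 1) * (inv_sqrt Zg ^ k) $ (k - 1))"
    unfolding inv_sqrt_coeff_exp_eq_log[OF assms Zf0 Zg0 f g] by (rule mult.left_commute)
  also have "\<dots> = (\<Sum>j=0..k-1. (-1) ^ (k + j - 1) * real (d3 (k + 2*j - 1) j)
      / (\<Prod>i=1..j. real (k + 2*i - 1)))"
    unfolding d3 sign alternating_sum_eq_inv_sqrt_coeff[OF \<open>k > 0\<close> Zg0 g, symmetric] sum_distrib_left
    by (simp only: mult.assoc times_divide_eq_right)
  finally show ?thesis .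
qed

end
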